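(* Let $p$ be an odd prime, $q_p(2)=\frac{2^{p-1}-1}{p}$, and let $M_{p-2}$ be the number of permutations of $p-2$ letters that have an even number of ascents and are distinct from the identity. Then $$q_p(2)\equiv\sum_{\substack{k=1\\ k\text{ odd}}}^{p-1}\frac1k\equiv 2M_{p-2}+1\pmod p.$$
   Context: Congruences are taken in $\mathbb{Z}_p$. For a permutation $(i_1,\dots,i_n)$ of $\{1,\dots,n\}$ (mapping $j$ to $i_j$), an ascent is an index $k$ with $i_{k+1}>i_k$. *)

theory Defs
  imports Complex_Main "HOL-Number_Theory.Cong" "HOL-Computational_Algebra.Primes"
    "HOL-Combinatorics.Permutations"
begin

text \<open>
  Every number involved is rational, so the ring of \<open>p\<close>-adic integers enters only through its
  intersection with the rationals, the fractions whose denominator is prime to \<open>p\<close>. For two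
  such fractions, the difference lies in \<open>p\<close> times the \<open>p\<close>-adic integers iff it is \<open>p\<close> times
  such a fraction.
\<close>

definition p_integral :: "nat \<Rightarrow> rat set" where
  "p_integral p = {of_int a / of_int b | a b. \<not> int p dvd b}"

text \<open>Both sides are required to be \<open>p\<close>-integral.\<close>

definition p_cong :: "nat \<Rightarrow> rat \<Rightarrow> rat \<Rightarrow> bool" where
  "p_cong p x y \<longleftrightarrow> x \<in> p_integral p \<and> y \<in> p_integral p \<and>
     (\<exists>z \<in> p_integral p. x - y = of_nat p * z)"

text \<open>The division is in the rationals, so nothing is truncated.\<close>

definition fermat_quotient :: "nat \<Rightarrow> int \<Rightarrow> rat" where
  "fermat_quotient p a = (of_int a ^ (p - 1) - 1) / of_nat p"

definition ascents :: "nat \<Rightarrow> (nat \<Rightarrow> nat) \<Rightarrow> nat set" where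
  "ascents n f = {k \<in> {1..<n}. f (k + 1) > f k}"

definition num_even_ascent_perms :: "nat \<Rightarrow> nat" where
  "num_even_ascent_perms n =
     card {f. f permutes {1..n} \<and> even (card (ascents n f)) \<and> f \<noteq> id}"

text \<open>On integers, \<^const>\<open>p_cong\<close> is the usual congruence.\<close>

lemma p_cong_of_int_iff:
  assumes "prime p"
  shows "p_cong p (of_int a) (of_int b) \<longleftrightarrow> [a = b] (mod int p)"
proof -
  have int_in: "of_int c \<in> p_integral p" for c
  proof -
    have "\<not> int p dvd 1"
      using assms by (metis not_prime_unit prime_nat_int_transfer)
    moreover have "rat_of_int c = of_int c / of_int 1" by simp
    ultimately show ?thesis
      unfolding p_integral_def by blast
  qed
  show ?thesis
  proof
    assume "p_cong p (of_int a) (of_int b)"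
    then obtain c d where d: "\<not> int p dvd d"
      and eq: "rat_of_int a - of_int b = of_nat p * (of_int c / of_int d)"
      unfolding p_cong_def p_integral_def by blast
    from d have "d \<noteq> 0" by auto
    with eq have "rat_of_int ((a - b) * d) = of_int (int p * c)"
      by (simp add: field_simps)
    then have "(a - b) * d = int p * c"
      by (simp only: of_int_eq_iff)
    then have "int p dvd (a - b) * d" by simp
    moreover have "prime (int p)" using assms by simp
    ultimately have "int p dvd a - b"
      using d by (simp add: prime_dvd_mult_iff)
    then show "[a = b] (mod int p)" by (simp add: cong_iff_dvd_diff)
  next
    assume "[a = b] (mod int p)"
    then obtain c where "a - b = int p * c"
      by (auto simp: cong_iff_dvd_diff)
    then have "rat_of_int a - of_int b = of_nat p * of_int c"
      by (metis of_int_diff of_int_mult of_int_of_nat_eq)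
    then show "p_cong p (of_int a) (of_int b)"
      using int_in by (auto simp: p_cong_def)
  qed
qed

end

(*
  Worpitzky's identity writes x^n as the sum of C(x + asc f, n) over the permutations f of n
  letters; it follows by inserting the letter n + 1 in all positions. For n = p - 2 and
  0 <= a <= p - 3, the sum of C(i + a, p - 2) over the odd i < p has a single term that is not
  divisible by p, namely the one with i + a = p - 2 or i + a = p - 1, and it is congruent to
  (-1)^a. Hence the alternating sum of (-1)^(asc f) is congruent to the sum of i^(p-2), that is
  of 1/i, over odd i. As the identity has an even number of ascents, that alternating sum is
  2 (M + 1) - (p - 2)!, and (p - 2)! is congruent to 1 by Wilson. For the Fermat quotient, sum
  C(p, k) / p = C(p - 1, k - 1) / k over odd k < p and use C(p - 1, j) = (-1)^j mod p.
*)

theory Submission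
  imports Defs "HOL-Combinatorics.Multiset_Permutations" "HOL-Number_Theory.Residues"
begin

section \<open>Worpitzky's identity for words, by insertion of a largest letter\<close>

fun list_ascents :: "'a::linorder list \<Rightarrow> nat" where
  "list_ascents (x # y # zs) = of_bool (x < y) + list_ascents (y # zs)"
| "list_ascents _ = 0"

text \<open>The recursion suits insertion arguments, while counting indices is the form in which
  \<open>ascents\<close> is given; this bridge is what \<open>list_ascents_map\<close>
  needs.\<close>

lemma list_ascents_eq_card:
  "list_ascents xs = card {k. Suc k < length xs \<and> xs ! k < xs ! Suc k}"
proof (induction xs rule: list_ascents.induct)
  case (1 x y zs)
  have "{k. Suc k < length (x # y # zs) \<and> (x # y # zs) ! k < (x # y # zs) ! Suc k} =
      {k. k = 0 \<and> x < y} \<union> Suc ` {k. Suc k < length (y # zs) \<and> (y # zs) ! k < (y # zs) ! Suc k}"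
    (is "?L = ?A \<union> Suc ` ?B")
  proof (rule Set.set_eqI)
    fix k show "k \<in> ?L \<longleftrightarrow> k \<in> ?A \<union> Suc ` ?B"
      by (cases k) auto
  qed
  moreover have "finite ?B"
    by (rule finite_subset[of _ "{..<length (y # zs)}"]) auto
  then have "card (?A \<union> Suc ` ?B) = card ?A + card (Suc ` ?B)"
    by (intro card_Un_disjoint) auto
  moreover have "card ?A = of_bool (x < y)"
    by auto
  ultimately show ?case
    using 1 by (simp add: card_image)
qed auto

lemma list_ascents_Cons_greater:
  assumes "\<forall>x\<in>set xs. x < m"
  shows "list_ascents (m # xs) = list_ascents xs"
  using assms by (cases xs) auto

text \<open>A largest letter put in front, or between the two letters of an ascent, leaves the
  number of ascents unchanged; in any other gap, or at the end of a nonempty word, it creates one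
  more. The weight \<open>g\<close> is arbitrary because the induction has to shift its
  argument.\<close>

lemma sum_list_ascents_insert:
  fixes g :: "nat \<Rightarrow> int"
  assumes "\<forall>x\<in>set xs. x < m"
  shows "(\<Sum>i\<le>length xs. g (list_ascents (take i xs @ m # drop i xs))) =
    (int (list_ascents xs) + 1) * g (list_ascents xs) +
    (int (length xs) - int (list_ascents xs)) * g (Suc (list_ascents xs))"
  using assms
proof (induction xs arbitrary: g)
  case (Cons x xs)
  show ?case
  proof (cases xs)
    case Nil
    with Cons.prems show ?thesis by (auto simp: algebra_simps)
  next
    case xs: (Cons y ys)
    define c :: nat where "c = of_bool (x < y)"
    have asc: "list_ascents (x # y # zs) = c + list_ascents (y # zs)" for zs
      by (simp add: c_def)
    \<comment> \<open>The hypothesis is used for the weight shifted by \<open>c\<close>, the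
      contribution of the pair \<open>x\<close>, \<open>y\<close>. Its term with \<open>m\<close> in
      front of \<open>y\<close> is kept apart: in the longer word that insertion would break this
      pair, and it is the only one that does. It is subtracted again below.\<close>
    have IH: "g (c + list_ascents (m # y # ys)) +
        (\<Sum>j\<le>length ys. g (c + list_ascents (y # take j ys @ m # drop j ys))) =
      (int (list_ascents xs) + 1) * g (c + list_ascents xs) +
      (int (length xs) - int (list_ascents xs)) * g (c + Suc (list_ascents xs))"
      using Cons.IH[of "\<lambda>a. g (c + a)"] Cons.prems
      unfolding xs by (simp add: sum.atMost_Suc_shift del: sum.atMost_Suc list_ascents.simps)
    have m: "list_ascents (m # xs) = list_ascents xs"
        "list_ascents (m # x # xs) = list_ascents (x # xs)"
      using Cons.prems by (auto intro!: list_ascents_Cons_greater simp del: list_ascents.simps)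
    have xm: "list_ascents (x # m # xs) = Suc (list_ascents xs)"
      using Cons.prems m(1) by simp
    have "(\<Sum>i\<le>length (x # xs). g (list_ascents (take i (x # xs) @ m # drop i (x # xs)))) =
        g (list_ascents (m # x # xs)) + g (list_ascents (x # m # xs)) +
        (\<Sum>j\<le>length ys. g (list_ascents (x # y # take j ys @ m # drop j ys)))"
      unfolding xs by (simp add: sum.atMost_Suc_shift del: sum.atMost_Suc list_ascents.simps)
    also have "\<dots> = g (list_ascents (x # xs)) + g (Suc (list_ascents xs)) +
        ((int (list_ascents xs) + 1) * g (c + list_ascents xs) +
        (int (length xs) - int (list_ascents xs)) * g (c + Suc (list_ascents xs)) -
        g (c + list_ascents xs))"
      unfolding m(2) xm asc using IH m(1) unfolding xs by (simp del: list_ascents.simps)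
    also have "\<dots> = (int (list_ascents (x # xs)) + 1) * g (list_ascents (x # xs)) +
        (int (length (x # xs)) - int (list_ascents (x # xs))) * g (Suc (list_ascents (x # xs)))"
      by (simp add: xs c_def algebra_simps)
    finally show ?thesis .
  qed
qed auto

text \<open>The letter \<open>Suc n\<close> occurs only once, so it determines where the word is
  cut, which gives injectivity. Surjectivity follows by counting, as (n + 1) * n! = (n +
  1)!.\<close>

lemma permutations_of_set_insert_Max:
  "bij_betw (\<lambda>(xs, i). take i xs @ Suc n # drop i xs)
     (permutations_of_set {1..n} \<times> {..n}) (permutations_of_set {1..Suc n})"
    (is "bij_betw ?f ?A ?B")
proof -
  have inj: "inj_on ?f ?A"
  proof (intro inj_onI, clarify)
    fix xs ys i j
    assume *: "xs \<in> permutations_of_set {1..n}" "ys \<in> permutations_of_set {1..n}" "i \<le> n" "j \<le> n"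
      and eq: "take i xs @ Suc n # drop i xs = take j ys @ Suc n # drop j ys"
    have "Suc n \<notin> set xs" "Suc n \<notin> set ys"
      using * by (auto simp: permutations_of_set_def)
    then have split: "take i xs = take j ys" "drop i xs = drop j ys"
      using eq append_Cons_eq_iff[of "Suc n" "take i xs" "drop i xs" "take j ys" "drop j ys"]
      by (meson in_set_takeD in_set_dropD)+
    then have "xs = ys"
      by (metis append_take_drop_id)
    moreover have "length xs = n" "length ys = n"
      using *(1,2) length_finite_permutations_of_set[of _ "{1..n}"] by auto
    ultimately show "xs = ys \<and> i = j"
      using split(1) *(3,4) by (metis length_take min.absorb2)
  qed
  have sub: "?f ` ?A \<subseteq> ?B"
  proof (clarify)
    fix xs i assume xs: "xs \<in> permutations_of_set {1..n}"
    have "set (take i xs) \<union> set (drop i xs) = {1..n}"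
      using xs by (metis append_take_drop_id permutations_of_setD(1) set_append)
    moreover from this have "Suc n \<notin> set (take i xs)" "Suc n \<notin> set (drop i xs)"
      by (metis Un_iff atLeastAtMost_iff not_less_eq_eq order_refl)+
    moreover have "distinct (take i xs @ drop i xs)"
      using xs by (simp add: permutations_of_set_def)
    ultimately show "take i xs @ Suc n # drop i xs \<in> permutations_of_set {1..Suc n}"
      by (auto simp: permutations_of_set_def atLeastAtMostSuc_conv simp del: append_take_drop_id)
  qed
  have "card (?f ` ?A) = card ?B"
    using inj by (simp add: card_image card_cartesian_product)
  with sub have "?f ` ?A = ?B"
    by (intro card_subset_eq) auto
  with inj show ?thesis
    by (simp add: bij_betw_def)
qed

text \<open>For \<open>g\<close> the indicator of a single value this is the recurrence of the
  Eulerian numbers; a general weight avoids introducing these numbers.\<close>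

lemma sum_permutations_insert_Max:
  fixes g :: "nat \<Rightarrow> int"
  shows "(\<Sum>xs\<in>permutations_of_set {1..Suc n}. g (list_ascents xs)) =
    (\<Sum>xs\<in>permutations_of_set {1..n}. (int (list_ascents xs) + 1) * g (list_ascents xs) +
       (int n - int (list_ascents xs)) * g (Suc (list_ascents xs)))"
proof -
  have "(\<Sum>xs\<in>permutations_of_set {1..Suc n}. g (list_ascents xs)) =
      (\<Sum>(xs, i)\<in>permutations_of_set {1..n} \<times> {..n}.
         g (list_ascents (take i xs @ Suc n # drop i xs)))"
    using sum.reindex_bij_betw[OF permutations_of_set_insert_Max[of n],
        of "\<lambda>xs. g (list_ascents xs)"]
    by (simp add: case_prod_unfold)
  also have "\<dots> = (\<Sum>xs\<in>permutations_of_set {1..n}.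
      \<Sum>i\<le>n. g (list_ascents (take i xs @ Suc n # drop i xs)))"
    by (simp add: sum.cartesian_product)
  also have "\<dots> = (\<Sum>xs\<in>permutations_of_set {1..n}.
      (int (list_ascents xs) + 1) * g (list_ascents xs) +
       (int n - int (list_ascents xs)) * g (Suc (list_ascents xs)))"
  proof (intro sum.cong refl)
    fix xs assume xs: "xs \<in> permutations_of_set {1..n}"
    then have "length xs = n" "\<forall>x\<in>set xs. x < Suc n"
      using length_finite_permutations_of_set[of xs "{1..n}"] by (auto simp: permutations_of_set_def)
    then show "(\<Sum>i\<le>n. g (list_ascents (take i xs @ Suc n # drop i xs))) =
      (int (list_ascents xs) + 1) * g (list_ascents xs) +
       (int n - int (list_ascents xs)) * g (Suc (list_ascents xs))"
      using sum_list_ascents_insert[of xs "Suc n" g] by simp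
  qed
  finally show ?thesis .
qed

text \<open>Working in the integers avoids truncated subtraction: for \<open>N < n\<close> the
  factor on the right is negative, but both binomials vanish.\<close>

lemma binomial_Suc_mult:
  "(int n + 1) * int (N choose Suc n) = (int N - int n) * int (N choose n)"
proof (cases "n \<le> N")
  case True
  have "Suc n * (N choose Suc n) = (N - n) * (N choose n)"
    using binomial_absorption[of n N] binomial_absorb_comp[of N n] by simp
  then have "int (Suc n * (N choose Suc n)) = int ((N - n) * (N choose n))"
    by simp
  with True show ?thesis
    by (simp add: of_nat_diff algebra_simps)
qed (simp add: binomial_eq_0)

lemma worpitzky:
  "(\<Sum>xs\<in>permutations_of_set {1..n}. int ((x + list_ascents xs) choose n)) = int x ^ n"
proof (induction n)
  case (Suc n)
  \<comment> \<open>Pascal's rule on the second binomial leaves (n + 1) C(x + a, n + 1) + (n - a)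
    C(x + a, n), and the first of these terms equals (x + a - n) C(x + a, n).\<close>
  have "(int a + 1) * int ((x + a) choose Suc n) + (int n - int a) * int ((x + Suc a) choose Suc n)
      = int x * int ((x + a) choose n)" for a
    using binomial_Suc_mult[of n "x + a"] by (simp add: algebra_simps)
  then show ?case
    using sum_permutations_insert_Max[of "\<lambda>a. int ((x + a) choose Suc n)" n] Suc
    by (simp add: sum_distrib_left[symmetric] del: binomial_Suc_Suc)
qed simp

section \<open>From words to permutations as functions\<close>

lemma bij_betw_permutes_lists:
  "bij_betw (\<lambda>f. map f [1..<Suc n]) {f. f permutes {1..n}} (permutations_of_set {1..n})"
    (is "bij_betw ?g ?A ?B")
proof -
  have inj: "inj_on ?g ?A"
  proof (intro inj_onI ext, clarify)
    fix f h x
    assume "f permutes {1..n}" "h permutes {1..n}" "map f [1..<Suc n] = map h [1..<Suc n]"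
    then show "f x = h x"
      by (cases "x \<in> {1..n}") (auto simp: permutes_not_in simp del: upt_Suc)
  qed
  have sub: "?g ` ?A \<subseteq> ?B"
    by (auto simp: permutations_of_set_def distinct_map permutes_inj_on permutes_image
        atLeastLessThanSuc_atLeastAtMost simp del: upt_Suc)
  have "card (?g ` ?A) = card ?B"
    using inj card_permutations[of "{1..n}" n] by (simp add: card_image)
  with sub have "?g ` ?A = ?B"
    by (intro card_subset_eq) auto
  with inj show ?thesis
    by (simp add: bij_betw_def)
qed

lemma list_ascents_map:
  "list_ascents (map f [1..<Suc n]) = card (ascents n f)"
proof -
  \<comment> \<open>Positions of letters start at 1 and list indices at 0, hence the shift by
    \<open>Suc\<close>.\<close>
  have "ascents n f = Suc ` {k. Suc k < n \<and> f (Suc k) < f (Suc (Suc k))}"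
  proof (rule Set.set_eqI)
    fix k show "k \<in> ascents n f \<longleftrightarrow> k \<in> Suc ` {k. Suc k < n \<and> f (Suc k) < f (Suc (Suc k))}"
      by (cases k) (auto simp: ascents_def)
  qed
  moreover have "{k. Suc k < length (map f [1..<Suc n]) \<and>
      map f [1..<Suc n] ! k < map f [1..<Suc n] ! Suc k} =
    {k. Suc k < n \<and> f (Suc k) < f (Suc (Suc k))}"
    by (auto simp del: upt_Suc)
  ultimately show ?thesis
    by (simp add: list_ascents_eq_card card_image del: upt_Suc)
qed

lemma sum_permutes_ascents:
  fixes g :: "nat \<Rightarrow> int"
  shows "(\<Sum>f | f permutes {1..n}. g (card (ascents n f))) =
    (\<Sum>xs\<in>permutations_of_set {1..n}. g (list_ascents xs))"
  using sum.reindex_bij_betw[OF bij_betw_permutes_lists[of n], of "\<lambda>xs. g (list_ascents xs)"]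
  unfolding list_ascents_map .

section \<open>Binomial coefficients modulo a prime\<close>

lemma prime_dvd_binomial:
  assumes "prime p" "n < p" "p \<le> m" "m < n + p"
  shows "p dvd (m choose n)"
proof -
  have "fact n * fact (m - n) * (m choose n) = (fact m :: nat)"
    using assms by (intro binomial_fact_lemma) simp
  moreover have "p dvd fact m" "\<not> p dvd fact n" "\<not> p dvd fact (m - n)"
    using assms by (auto simp: prime_dvd_fact_iff)
  ultimately show ?thesis
    using assms(1) by (metis prime_dvd_mult_iff)
qed

text \<open>Two neighbours in row p - 1 of Pascal's triangle add up to an inner entry of row p,
  which is divisible by p; so the entries alternate in sign modulo p, starting from 1.\<close>

lemma binomial_prime_minus_one_cong:
  assumes "prime p" "j < p"
  shows "[int ((p - 1) choose j) = (-1) ^ j] (mod int p)"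
  using assms(2)
proof (induction j)
  case (Suc j)
  have "p choose Suc j = ((p - 1) choose j) + ((p - 1) choose Suc j)"
    using Suc.prems by (cases p) auto
  moreover have "p dvd p choose Suc j"
    using assms(1) Suc.prems by (intro prime_dvd_binomial) auto
  ultimately have "int p dvd int ((p - 1) choose j) + int ((p - 1) choose Suc j)"
    by (metis of_nat_add of_nat_dvd_iff)
  moreover have "int p dvd int ((p - 1) choose j) - (-1) ^ j"
    using Suc by (simp add: cong_iff_dvd_diff)
  ultimately have "int p dvd (int ((p - 1) choose j) + int ((p - 1) choose Suc j)) -
      (int ((p - 1) choose j) - (-1) ^ j)"
    by (rule dvd_diff)
  then show ?case
    by (simp add: cong_iff_dvd_diff add.commute)
qed simp

lemma sum_odd_binomial_cong:
  assumes "prime p" "odd p" "a \<le> p - 3"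
  shows "[(\<Sum>i | i \<in> {1..p - 1} \<and> odd i. int ((i + a) choose (p - 2))) = (-1) ^ a] (mod int p)"
proof -
  have p: "p \<ge> 3"
    using assms(1,2) by (metis One_nat_def Suc_1 even_numeral le_antisym not_less_eq_eq
        numeral_3_eq_3 prime_ge_2_nat)
  \<comment> \<open>As \<open>p - 2\<close> is odd, the odd one among the candidates
    \<open>p - 2 - a\<close> and \<open>p - 1 - a\<close> is the first for even \<open>a\<close> and
    the second for odd \<open>a\<close>. The bound on \<open>a\<close> makes it at least 1.\<close>
  define b where "b = p - 2 - a + of_bool (odd a)"
  have b: "b \<in> {1..p - 1}" "odd b"
    using assms p by (auto simp: b_def)
  have "[int ((i + a) choose (p - 2)) = (if i = b then (-1) ^ a else 0)] (mod int p)"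
    if i: "i \<in> {1..p - 1}" "odd i" for i
  proof (cases "i = b")
    case True
    show ?thesis
    proof (cases "even a")
      case True
      then have "i + a = p - 2"
        using \<open>i = b\<close> assms(3) p by (simp add: b_def)
      then show ?thesis
        using True \<open>i = b\<close> by simp
    next
      case False
      then have "i + a = p - 1"
        using \<open>i = b\<close> assms(3) p by (simp add: b_def)
      moreover have "(-1) ^ (p - 2) = (-1 :: int)"
        using assms(2) p by simp
      ultimately show ?thesis
        using False \<open>i = b\<close> binomial_prime_minus_one_cong[OF assms(1), of "p - 2"] p by simp
    qed
  next
    case False
    have "odd (p - 2)" "even (p - 1)"
      using assms(2) p by auto
    then have i_le: "i \<le> p - 2"
      using i p by (cases "i = p - 1") auto
    have "i + a \<noteq> p - 2"
    proof
      assume eq: "i + a = p - 2"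
      with \<open>odd (p - 2)\<close> i(2) have "even a"
        by (metis odd_add)
      with eq False show False
        by (simp add: b_def)
    qed
    moreover have "i + a \<noteq> p - 1"
    proof
      assume eq: "i + a = p - 1"
      with \<open>even (p - 1)\<close> i(2) have "odd a"
        by (metis odd_add)
      with eq False assms(3) p show False
        by (simp add: b_def)
    qed
    \<comment> \<open>Below \<open>p - 2\<close> the binomial is zero. From \<open>p\<close> on,
      \<open>i \<le> p - 2\<close> and \<open>a \<le> p - 3\<close> keep \<open>i + a\<close> under
      \<open>(p - 2) + p\<close>, so that \<open>prime_dvd_binomial\<close> applies.\<close>
    ultimately consider "i + a < p - 2" | "i + a \<ge> p"
      by linarith
    then show ?thesis
    proof cases
      case 2
      then have "p dvd (i + a) choose (p - 2)"
        using assms(1,3) i_le p by (intro prime_dvd_binomial) auto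
      then have "int p dvd int ((i + a) choose (p - 2))"
        by simp
      then show ?thesis
        using False by (simp add: cong_0_iff)
    qed (use False in \<open>simp add: binomial_eq_0\<close>)
  qed
  then have "[(\<Sum>i | i \<in> {1..p - 1} \<and> odd i. int ((i + a) choose (p - 2))) =
      (\<Sum>i | i \<in> {1..p - 1} \<and> odd i. if i = b then (-1) ^ a else 0)] (mod int p)"
    by (intro cong_sum) auto
  moreover have "(\<Sum>i | i \<in> {1..p - 1} \<and> odd i. if i = b then (-1) ^ a else 0) = (-1 :: int) ^ a"
    using b by (subst sum.delta) auto
  ultimately show ?thesis
    by simp
qed

section \<open>The alternating sum over permutations and the count of even ascents\<close>

lemma card_ascents_le: "card (ascents n f) \<le> n - 1"
proof -
  have "ascents n f \<subseteq> {1..<n}"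
    by (auto simp: ascents_def)
  then show ?thesis
    using card_mono[of "{1..<n}" "ascents n f"] by simp
qed

lemma worpitzky_ascents:
  "(\<Sum>f | f permutes {1..n}. int ((x + card (ascents n f)) choose n)) = int x ^ n"
  using sum_permutes_ascents[of "\<lambda>a. int ((x + a) choose n)" n] worpitzky[of x n] by (rule trans)

text \<open>A double sum of binomials is evaluated in both orders: summing over odd \<open>i\<close>
  first gives the sign of each permutation's ascent number modulo p, summing over \<open>f\<close>
  first gives the power of \<open>i\<close> by Worpitzky.\<close>

lemma alternating_ascents_cong:
  assumes "prime p" "odd p"
  shows "[(\<Sum>f | f permutes {1..p - 2}. (-1) ^ card (ascents (p - 2) f)) =
    (\<Sum>i | i \<in> {1..p - 1} \<and> odd i. int i ^ (p - 2))] (mod int p)"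
proof -
  let ?c = "\<lambda>i f. int ((i + card (ascents (p - 2) f)) choose (p - 2))"
  have "[(\<Sum>f | f permutes {1..p - 2}. \<Sum>i | i \<in> {1..p - 1} \<and> odd i. ?c i f) =
      (\<Sum>f | f permutes {1..p - 2}. (-1) ^ card (ascents (p - 2) f))] (mod int p)"
  proof (rule cong_sum)
    fix f
    show "[(\<Sum>i | i \<in> {1..p - 1} \<and> odd i. ?c i f) = (-1) ^ card (ascents (p - 2) f)] (mod int p)"
      using card_ascents_le[of "p - 2" f] by (intro sum_odd_binomial_cong assms) simp
  qed
  moreover have "(\<Sum>f | f permutes {1..p - 2}. \<Sum>i | i \<in> {1..p - 1} \<and> odd i. ?c i f) =
      (\<Sum>i | i \<in> {1..p - 1} \<and> odd i. int i ^ (p - 2))"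
    by (subst sum.swap) (simp only: worpitzky_ascents)
  ultimately show ?thesis
    by (simp only: cong_sym_eq)
qed

text \<open>The sum 1 + (-1)^k is twice the indicator of even k. The extra 2 on the left accounts
  for the identity, whose n - 1 ascents are even in number because n is odd.\<close>

lemma two_num_even_ascent_perms:
  assumes "odd n"
  shows "2 * int (num_even_ascent_perms n) + 2 =
    fact n + (\<Sum>f | f permutes {1..n}. (-1) ^ card (ascents n f))"
proof -
  let ?P = "{f. f permutes {1..n}}"
  let ?E = "{f \<in> ?P. even (card (ascents n f))}"
  have fin: "finite ?P"
    by (rule finite_permutations) simp
  have "ascents n id = {1..<n}"
    by (auto simp: ascents_def)
  then have "id \<in> ?E"
    using assms by (simp add: permutes_id)
  then have "card ?E = Suc (card (?E - {id}))"
    using fin by (intro card.remove) auto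
  moreover have "{f. f permutes {1..n} \<and> even (card (ascents n f)) \<and> f \<noteq> id} = ?E - {id}"
    by blast
  ultimately have "card ?E = Suc (num_even_ascent_perms n)"
    unfolding num_even_ascent_perms_def by (simp only:)
  moreover have "(\<Sum>f\<in>?P. of_bool (even (card (ascents n f)))) = int (card ?E)"
    using fin by (simp add: Int_def)
  moreover have "(\<Sum>f\<in>?P. 2 * of_bool (even (card (ascents n f)))) =
      (\<Sum>f\<in>?P. 1 + (-1 :: int) ^ card (ascents n f))"
    by (rule sum.cong[OF refl]) (simp add: of_bool_def)
  moreover have "(\<Sum>f\<in>?P. 1) = (fact n :: int)"
    using card_permutations[of "{1..n}" n] by (simp only: sum_constant) simp
  ultimately show ?thesis
    unfolding sum.distrib sum_distrib_left[symmetric] by simp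
qed

text \<open>By Wilson, (p - 1)! = (p - 1) * (p - 2)! is congruent to -1, and p - 1 is congruent to
  -1 as well.\<close>

lemma fact_prime_minus_two_cong:
  assumes "prime p"
  shows "[fact (p - 2) = 1] (mod int p)"
proof -
  have p: "p \<ge> 2"
    using assms by (rule prime_ge_2_nat)
  then have "p - 1 = Suc (p - 2)"
    by simp
  then have "fact (p - 1) = (int p - 1) * fact (p - 2)"
    using p by (simp add: of_nat_diff)
  then have "int p dvd (int p - 1) * fact (p - 2) + 1"
    using wilson_theorem[OF assms] by (simp add: cong_iff_dvd_diff)
  then have "int p dvd int p * fact (p - 2) - ((int p - 1) * fact (p - 2) + 1)"
    by (intro dvd_diff) auto
  then show ?thesis
    by (simp add: cong_iff_dvd_diff algebra_simps)
qed

section \<open>Arithmetic of p-integral rationals and their congruences\<close>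

lemma p_integral_of_int: "prime p \<Longrightarrow> of_int c \<in> p_integral p"
  using p_cong_of_int_iff[of p c c] by (simp add: p_cong_def)

lemma p_integral_add:
  assumes "prime p" "x \<in> p_integral p" "y \<in> p_integral p"
  shows "x + y \<in> p_integral p"
proof -
  obtain a b c d where *: "x = of_int a / of_int b" "\<not> int p dvd b"
      "y = of_int c / of_int d" "\<not> int p dvd d"
    using assms(2,3) unfolding p_integral_def by blast
  then have "b \<noteq> 0" "d \<noteq> 0"
    by auto
  then have "x + y = of_int (a * d + c * b) / of_int (b * d)"
    using * by (simp add: field_simps)
  moreover have "\<not> int p dvd b * d"
    using assms(1) * by (simp add: prime_dvd_mult_iff)
  ultimately show ?thesis
    unfolding p_integral_def by blast
qed

lemma p_integral_minus:
  assumes "x \<in> p_integral p"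
  shows "- x \<in> p_integral p"
proof -
  obtain a b where "x = of_int a / of_int b" "\<not> int p dvd b"
    using assms unfolding p_integral_def by blast
  then have "- x = of_int (- a) / of_int b" "\<not> int p dvd b"
    by simp_all
  then show ?thesis
    unfolding p_integral_def by blast
qed

lemma p_cong_sym: "p_cong p x y \<Longrightarrow> p_cong p y x"
  unfolding p_cong_def by (metis minus_diff_eq mult_minus_right p_integral_minus)

lemma p_cong_add:
  assumes "prime p" "p_cong p x y" "p_cong p x' y'"
  shows "p_cong p (x + x') (y + y')"
proof -
  obtain z z' where "z \<in> p_integral p" "x - y = of_nat p * z"
      "z' \<in> p_integral p" "x' - y' = of_nat p * z'"
    using assms(2,3) unfolding p_cong_def by blast
  then have "z + z' \<in> p_integral p" "x + x' - (y + y') = of_nat p * (z + z')"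
    using assms(1) by (auto simp: p_integral_add algebra_simps)
  then show ?thesis
    using assms unfolding p_cong_def by (blast intro: p_integral_add)
qed

lemma p_cong_trans:
  assumes "prime p" "p_cong p x y" "p_cong p y z"
  shows "p_cong p x z"
proof -
  obtain u v where "u \<in> p_integral p" "x - y = of_nat p * u"
      "v \<in> p_integral p" "y - z = of_nat p * v"
    using assms(2,3) unfolding p_cong_def by blast
  then have "u + v \<in> p_integral p" "x - z = of_nat p * (u + v)"
    using assms(1) by (auto simp: p_integral_add algebra_simps)
  then show ?thesis
    using assms(2,3) unfolding p_cong_def by blast
qed

lemma p_cong_sum:
  assumes "prime p" "\<And>i. i \<in> A \<Longrightarrow> p_cong p (f i) (g i)"
  shows "p_cong p (sum f A) (sum g A)"
proof -
  \<comment> \<open>This settles the empty index set and also an infinite one, over which both sums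
    are 0 by convention.\<close>
  have "p_cong p 0 0"
    using p_cong_of_int_iff[OF assms(1), of 0 0] by simp
  then show ?thesis
    using assms(2) by (induction A rule: infinite_finite_induct) (auto intro!: p_cong_add assms(1))
qed

text \<open>This replaces a fraction by an integer representative: dividing a - c b = p d by b,
  which is prime to p, keeps the quotient d / b p-integral.\<close>

lemma p_cong_divide_of_int:
  assumes "prime p" "\<not> int p dvd b" "[a = c * b] (mod int p)"
  shows "p_cong p (of_int a / of_int b) (of_int c)"
proof -
  obtain d where "a - c * b = int p * d"
    using assms(3) by (auto simp: cong_iff_dvd_diff)
  then have "rat_of_int a - of_int c * of_int b = of_nat p * of_int d"
    by (metis of_int_diff of_int_mult of_int_of_nat_eq)
  moreover have "b \<noteq> 0"
    using assms(2) by auto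
  ultimately have "of_int a / of_int b - rat_of_int c = of_nat p * (of_int d / of_int b)"
    by (simp add: field_simps)
  moreover have "of_int a / of_int b \<in> p_integral p" "of_int d / of_int b \<in> p_integral p"
    using assms(2) unfolding p_integral_def by blast+
  ultimately show ?thesis
    using p_integral_of_int[OF assms(1)] unfolding p_cong_def by blast
qed

section \<open>The Fermat quotient and the comparison of the three quantities\<close>

lemma fermat_quotient_two_eq:
  assumes "prime p" "odd p"
  shows "fermat_quotient p 2 =
    (\<Sum>k | k \<in> {1..p - 1} \<and> odd k. of_nat ((p - 1) choose (k - 1)) / of_nat k)"
proof -
  let ?O = "{k. k \<in> {1..p - 1} \<and> odd k}"
  have p: "p > 0"
    using assms(1) by (rule prime_gt_0_nat)
  \<comment> \<open>Since p is odd, \<open>k = p\<close> is among the odd indices; its binomial C(p,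
    p) = 1 cancels the -1 in the Fermat quotient. The whole odd half of row p sums to 2^(p -
    1).\<close>
  have "{k \<in> {..p}. odd k} = insert p ?O"
    using assms p by (auto intro: Suc_leI odd_pos)
  moreover have "p \<notin> ?O"
    using p by auto
  ultimately have "(\<Sum>k\<le>p. if odd k then rat_of_nat (p choose k) else 0) =
      1 + (\<Sum>k\<in>?O. of_nat (p choose k))"
    by (simp add: sum.inter_filter[symmetric])
  moreover have "2 * (\<Sum>k\<le>p. if odd k then rat_of_nat (p choose k) else 0) = 2 * 2 ^ (p - 1)"
    using p by (subst choose_odd_sum) (simp_all flip: power_Suc)
  ultimately have "fermat_quotient p 2 = (\<Sum>k\<in>?O. of_nat (p choose k)) / of_nat p"
    by (simp add: fermat_quotient_def)
  also have "\<dots> = (\<Sum>k\<in>?O. of_nat ((p - 1) choose (k - 1)) / of_nat k)"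
    unfolding sum_divide_distrib
  proof (intro sum.cong refl)
    fix k assume "k \<in> ?O"
    then have k: "k > 0"
      by auto
    then have "k * (p choose k) = p * ((p - 1) choose (k - 1))"
      by (simp add: times_binomial_minus1_eq)
    then have "rat_of_nat k * of_nat (p choose k) = of_nat p * of_nat ((p - 1) choose (k - 1))"
      by (metis of_nat_mult)
    then show "rat_of_nat (p choose k) / of_nat p = of_nat ((p - 1) choose (k - 1)) / of_nat k"
      using k p by (simp add: field_simps)
  qed
  finally show ?thesis .
qed

theorem theorem3:
  fixes p :: nat
  assumes "prime p" and "odd p"
  shows "p_cong p (fermat_quotient p 2) (\<Sum>k | k \<in> {1..p - 1} \<and> odd k. 1 / of_nat k) \<and>
    p_cong p (\<Sum>k | k \<in> {1..p - 1} \<and> odd k. 1 / of_nat k)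
      (2 * of_nat (num_even_ascent_perms (p - 2)) + 1)"
proof -
  let ?O = "{k. k \<in> {1..p - 1} \<and> odd k}"
  \<comment> \<open>An integer to which all three quantities are compared: by Fermat, k^(p - 2) is
    the inverse of k modulo p.\<close>
  define T where "T = (\<Sum>k\<in>?O. int k ^ (p - 2))"
  have p: "p \<ge> 2"
    using assms(1) by (rule prime_ge_2_nat)
  \<comment> \<open>Allowing any numerator congruent to 1 covers both 1 / k and C(p - 1, k - 1) /
    k.\<close>
  have frac: "p_cong p (of_int a / of_nat k) (of_int (int k ^ (p - 2)))"
    if "k \<in> ?O" and a: "[a = 1] (mod int p)" for a k
  proof -
    have "\<not> p dvd k"
      using that p by (auto dest: dvd_imp_le)
    then have "[k ^ (p - 1) = 1] (mod p)"
      by (rule fermat_theorem[OF assms(1)])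
    then have "[int k ^ (p - 1) = 1] (mod int p)"
      by (metis cong_int_iff of_nat_1 of_nat_power)
    moreover have "int k ^ (p - 1) = int k ^ (p - 2) * int k"
      using p by (metis Suc_1 Suc_diff_Suc Suc_le_lessD power_Suc2)
    ultimately have "[a = int k ^ (p - 2) * int k] (mod int p)"
      using a by (metis cong_sym cong_trans)
    then show ?thesis
      using p_cong_divide_of_int[OF assms(1), of "int k" a "int k ^ (p - 2)"] \<open>\<not> p dvd k\<close>
      by simp
  qed
  have harmonic: "p_cong p (\<Sum>k\<in>?O. 1 / of_nat k) (of_int T)"
    unfolding T_def of_int_sum
    by (rule p_cong_sum[OF assms(1)]) (use frac[of _ 1] in simp)
  have quotient: "p_cong p (fermat_quotient p 2) (of_int T)"
    unfolding T_def of_int_sum fermat_quotient_two_eq[OF assms]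
  proof (rule p_cong_sum[OF assms(1)])
    fix k assume k: "k \<in> ?O"
    \<comment> \<open>The sign (-1)^(k - 1) is 1 because k is odd.\<close>
    then have "[int ((p - 1) choose (k - 1)) = 1] (mod int p)"
      using binomial_prime_minus_one_cong[OF assms(1), of "k - 1"] by auto
    from frac[OF k this]
    show "p_cong p (of_nat ((p - 1) choose (k - 1)) / of_nat k) (of_int (int k ^ (p - 2)))"
      by simp
  qed
  have "odd (p - 2)"
    using assms(2) p by simp
  from two_num_even_ascent_perms[OF this]
  have "2 * int (num_even_ascent_perms (p - 2)) + 1 =
      fact (p - 2) + (\<Sum>f | f permutes {1..p - 2}. (-1) ^ card (ascents (p - 2) f)) - 1"
    by linarith
  also have "[\<dots> = 1 + T - 1] (mod int p)"
    unfolding T_def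
    by (intro cong_diff cong_add cong_refl fact_prime_minus_two_cong alternating_ascents_cong assms)
  finally have "[2 * int (num_even_ascent_perms (p - 2)) + 1 = T] (mod int p)"
    by simp
  then have "p_cong p (of_int (2 * int (num_even_ascent_perms (p - 2)) + 1)) (of_int T)"
    by (rule p_cong_of_int_iff[OF assms(1), THEN iffD2])
  then have "p_cong p (2 * of_nat (num_even_ascent_perms (p - 2)) + 1) (of_int T)"
    by simp
  with harmonic quotient show ?thesis
    using p_cong_sym p_cong_trans[OF assms(1)] by blast
qed

end
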